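(* Let $\|\cdot\|$ be a rational polyhedral norm on $\mathbb{R}^n$, and let $P$ be its unit ball. Let $P^\circ$ be the polar set of $P$. Then the horofunction compactification of $\mathbb{R}^n$ with respect to $\|\cdot\|$ is homeomorphic to $P^\circ$.
   Context: An asymmetric norm on $\mathbb{R}^n$ is a function $\|\cdot\|:\mathbb{R}^n\to\mathbb{R}_{\ge 0}$ such that $\|x\|=0$ implies $x=0$; $\|\alpha x\|=\alpha\|x\|$ for all $\alpha\ge 0$; and $\|x+y\|\le\|x\|+\|y\|$. It is a polyhedral norm if its unit ball $P=\{x:\|x\|\le 1\}$ is a convex polytope (which then contains the origin in its interior), and a rational polyhedral norm if moreover all vertices of $P$ lie in $\mathbb{Z}^n$. The norm induces the (possibly asymmetric) distance $d_P(x,y)=\|y-x\|$. The polar set is $P^\circ=\{v\in\mathbb{R}^n:\langle v,u\rangle\ge -1\text{ for all }u\in P\}$, with $\langle\cdot,\cdot\rangle$ the standard inner product. Let $C(\mathbb{R}^n)$ be the space of continuous real functions on $\mathbb{R}^n$ with the compact-open topology, and let $\psi:\mathbb{R}^n\to C(\mathbb{R}^n)$, $\psi(x)=d_P(\cdot,x)-d_P(0,x)$. The horofunction compactification of $\mathbb{R}^n$ with respect to $\|\cdot\|$ is the (compact) closure of $\psi(\mathbb{R}^n)$ in $C(\mathbb{R}^n)$. *)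

theory Defs
  imports "HOL-Analysis.Analysis"
begin

definition asymmetric_norm :: "('a::real_vector \<Rightarrow> real) \<Rightarrow> bool" where
  "asymmetric_norm N \<longleftrightarrow>
     (\<forall>x. N x \<ge> 0) \<and>
     (\<forall>x. N x = 0 \<longrightarrow> x = 0) \<and>
     (\<forall>\<alpha> x. \<alpha> \<ge> 0 \<longrightarrow> N (\<alpha> *\<^sub>R x) = \<alpha> * N x) \<and>
     (\<forall>x y. N (x + y) \<le> N x + N y)"

definition unit_ball :: "('a::real_vector \<Rightarrow> real) \<Rightarrow> 'a set" where
  "unit_ball N = {x. N x \<le> 1}"

definition polyhedral_norm :: "('a::euclidean_space \<Rightarrow> real) \<Rightarrow> bool" where
  "polyhedral_norm N \<longleftrightarrow> asymmetric_norm N \<and> polytope (unit_ball N)"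

text \<open>The vertices of a polytope are its extreme points.\<close>

definition rational_polyhedral_norm :: "(real ^ 'n \<Rightarrow> real) \<Rightarrow> bool" where
  "rational_polyhedral_norm N \<longleftrightarrow>
     polyhedral_norm N \<and>
     (\<forall>v. v extreme_point_of unit_ball N \<longrightarrow> (\<forall>i. v $ i \<in> \<int>))"

definition norm_dist :: "('a::real_vector \<Rightarrow> real) \<Rightarrow> 'a \<Rightarrow> 'a \<Rightarrow> real" where
  "norm_dist N x y = N (y - x)"

text \<open>The sign convention is the one with lower bound \<open>-1\<close>; the other common
  convention, \<open>v \<bullet> u \<le> 1\<close>, gives the reflection of this set in the origin.\<close>

definition polar_set :: "'a::real_inner set \<Rightarrow> 'a set" where
  "polar_set P = {v. \<forall>u\<in>P. v \<bullet> u \<ge> -1}"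

text \<open>The compact-open topology on the space of continuous maps. Its carrier is the set of
  continuous functions, since the empty compact set is admitted in the subbasis.\<close>

definition compact_open_topology ::
    "('a::topological_space \<Rightarrow> 'b::topological_space) topology" where
  "compact_open_topology =
     topology_generated_by
       {{f. continuous_on UNIV f \<and> f ` K \<subseteq> U} | K U. compact K \<and> open U}"

lemma topspace_compact_open_topology:
  "topspace compact_open_topology = {f. continuous_on UNIV f}"
  unfolding compact_open_topology_def topology_generated_by_topspace
  by (auto intro!: exI[of _ "{}"])

definition horofunction_embedding ::
    "('a::real_vector \<Rightarrow> real) \<Rightarrow> 'a \<Rightarrow> 'a \<Rightarrow> real" where
  "horofunction_embedding N x = (\<lambda>z. norm_dist N z x - norm_dist N 0 x)"

definition horofunction_compactification ::
    "('a::euclidean_space \<Rightarrow> real) \<Rightarrow> ('a \<Rightarrow> real) topology" where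
  "horofunction_compactification N =
     subtopology compact_open_topology
       (compact_open_topology closure_of range (horofunction_embedding N))"

end

theory Submission
  imports Defs
begin

text \<open>Let \<open>V\<close> be the set of vertices of the polar polytope \<open>K\<close>. By duality
\<open>N x = (MAX w\<in>V. - (w \<bullet> x))\<close>, so \<open>N\<close> is the tropical (max-plus) counterpart of the log-partition
function \<open>x \<mapsto> ln (\<Sum>w\<in>V. exp (- (w \<bullet> x)))\<close>. Both sides of the homeomorphism are images of one compact
space: the closure \<open>G\<close>, in the cube \<open>[0,1]\<^sup>V\<close>, of the family of Gibbs weights
\<open>w \<mapsto> exp (w \<bullet> x) / (\<Sum>v\<in>V. exp (v \<bullet> x))\<close>. For integral \<open>V\<close> this is the nonnegative part of a
projective toric variety.

The first map sends weights \<open>p\<close> to their mean \<open>\<Sum>w\<in>V. p w *\<^sub>R w\<close> (the moment map). Its restriction to \<open>G\<close>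
is a homeomorphism onto \<open>K\<close> (Birch's theorem). It is onto since each interior point \<open>q\<close> of
\<open>K\<close> is the mean at the minimiser of the coercive function \<open>x \<mapsto> \<Sum>v\<in>V. exp ((v - q) \<bullet> x)\<close>
(\<open>interior_hull_subset_gibbs_means\<close>). It is injective since every affine relation
between points of \<open>V\<close> gives a binomial equation between the weights, which persists on the closure,
and the relation supplied by the difference of two weights with equal means contradicts its own
binomial equation (\<open>inj_on_mean_gibbs_closure\<close>).

The second map sends \<open>p\<close> to the function
\<open>z \<mapsto> ln (MAX w\<in>V. p w * exp (w \<bullet> z)) - ln (MAX w\<in>V. p w)\<close>. At the Gibbs weights of
\<open>- x\<close> it is the image of \<open>x\<close> under the embedding into continuous functions
(\<open>log_profile_gibbs\<close>), it is continuous into the compact-open topology, and it is injective because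
the growth of the maximum along a direction exposing a vertex \<open>v\<close> recovers \<open>p v\<close>
(\<open>inj_on_log_profile\<close>). As \<open>G\<close> is compact, its image is exactly the closure of the embedded space.\<close>

section \<open>Maps out of compact closures and into the compact-open topology\<close>

lemma Hausdorff_compact_open_topology:
  "Hausdorff_space (compact_open_topology :: ('a::topological_space \<Rightarrow> 'b::t2_space) topology)"
  unfolding Hausdorff_space_def topspace_compact_open_topology
proof (intro allI impI, elim conjE)
  fix f g :: "'a \<Rightarrow> 'b"
  assume f: "f \<in> {f. continuous_on UNIV f}" and g: "g \<in> {f. continuous_on UNIV f}" and "f \<noteq> g"
  then obtain z where "f z \<noteq> g z" by blast
  then obtain A B where AB: "open A" "open B" "f z \<in> A" "g z \<in> B" "A \<inter> B = {}"
    using hausdorff by metis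
  define S :: "'b set \<Rightarrow> ('a \<Rightarrow> 'b) set"
    where "S U = {h. continuous_on UNIV h \<and> h ` {z} \<subseteq> U}" for U
  have "openin compact_open_topology (S U)" if "open U" for U
    unfolding compact_open_topology_def S_def using that
    by (intro topology_generated_by_Basis) (use compact_sing in blast)
  then show "\<exists>U V. openin compact_open_topology U \<and> openin compact_open_topology V \<and>
                  f \<in> U \<and> g \<in> V \<and> disjnt U V"
    using AB f g by (intro exI[of _ "S A"] exI[of _ "S B"]) (auto simp: S_def disjnt_def)
qed

text \<open>Joint continuity makes \<open>{(x, z). F x z \<in> U}\<close> open; the tube lemma then provides, for compact \<open>K\<close>
with \<open>F x ` K \<subseteq> U\<close>, a neighbourhood of \<open>x\<close> on which the inclusion persists.\<close>

lemma continuous_map_into_compact_open_topology: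
  fixes F :: "'c \<Rightarrow> 'a::topological_space \<Rightarrow> 'b::topological_space"
  assumes F: "continuous_map (prod_topology X euclidean) euclidean (\<lambda>(x, z). F x z)"
  shows "continuous_map X compact_open_topology F"
  unfolding compact_open_topology_def
proof (rule continuous_on_generated_topo)
  have cont: "continuous_on UNIV (F x)" if "x \<in> topspace X" for x
  proof -
    have "continuous_map euclidean (prod_topology X euclidean) (\<lambda>z::'a. (x, z))"
      using that by (simp add: continuous_map_pairedI)
    from continuous_map_compose[OF this F] show ?thesis by (simp add: o_def)
  qed
  show "F ` topspace X \<subseteq> \<Union> {{f. continuous_on UNIV f \<and> f ` K \<subseteq> U} | K U. compact K \<and> open U}"
    unfolding topspace_compact_open_topology
        [unfolded compact_open_topology_def topology_generated_by_topspace]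
    using cont by (simp add: image_subset_iff)
  fix S :: "('a \<Rightarrow> 'b) set"
  assume "S \<in> {{f. continuous_on UNIV f \<and> f ` K \<subseteq> U} | K U. compact K \<and> open U}"
  then obtain K U where S: "S = {f. continuous_on UNIV f \<and> f ` K \<subseteq> U}" and "compact K" "open U"
    by blast
  define W where "W = {p \<in> topspace (prod_topology X euclidean). (\<lambda>(x, z). F x z) p \<in> U}"
  have W: "openin (prod_topology X euclidean) W"
    unfolding W_def using \<open>open U\<close> by (intro openin_continuous_map_preimage[OF F]) simp
  have "\<exists>T. openin X T \<and> x \<in> T \<and> T \<subseteq> F -` S \<inter> topspace X" if x: "x \<in> F -` S \<inter> topspace X" for x
  proof -
    have "{x} \<times> K \<subseteq> W" using x by (simp add: W_def S subset_iff image_subset_iff)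
    from tube_lemma_right[OF W _ _ this] obtain T V
      where "openin X T" "x \<in> T" "K \<subseteq> V" "T \<times> V \<subseteq> W"
      using x \<open>compact K\<close> by auto
    moreover from this have "T \<subseteq> F -` S \<inter> topspace X"
      using cont openin_subset[of X T] by (auto simp: W_def S subset_iff)
    ultimately show ?thesis by blast
  qed
  then show "openin X (F -` S \<inter> topspace X)"
    by (subst openin_subopen) blast
qed

text \<open>The image of the compact closure is compact, hence closed, so it cannot be smaller than the
closure of the image; injectivity then suffices for a homeomorphism. This one principle serves both
the moment map and the map to horofunctions.\<close>

lemma closure_homeomorphic_to_closure_of_image:
  assumes "compact_space X" "Hausdorff_space Y" "A \<subseteq> topspace X"
    and f: "continuous_map (subtopology X (X closure_of A)) Y f"
    and inj: "inj_on f (X closure_of A)"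
  shows "subtopology X (X closure_of A) homeomorphic_space subtopology Y (Y closure_of (f ` A))"
proof -
  let ?C = "X closure_of A"
  let ?X = "subtopology X ?C"
  have sub: "A \<subseteq> ?C" "?C \<subseteq> topspace X"
    using assms(3) by (simp_all add: closure_of_subset closure_of_subset_topspace)
  have comp: "compactin X ?C"
    using assms(1) by (simp add: closedin_compact_space)
  then have "compactin ?X ?C"
    by (simp add: compactin_subtopology)
  then have "closedin Y (f ` ?C)"
    using assms(2) f by (intro compactin_imp_closedin image_compactin)
  then have "Y closure_of (f ` A) \<subseteq> f ` ?C"
    using sub by (intro closure_of_minimal image_mono)
  moreover have "f ` ?C \<subseteq> Y closure_of (f ` A)"
    using continuous_map_image_closure_subset[OF f, of A] sub
    by (simp add: closure_of_subtopology inf.absorb2)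
  ultimately have image: "f ` ?C = Y closure_of (f ` A)"
    by simp
  have "homeomorphic_map (subtopology X ?C) (subtopology Y (Y closure_of (f ` A))) f"
  proof (rule continuous_imp_homeomorphic_map)
    show "compact_space (subtopology X ?C)"
      using comp compact_space_subtopology by blast
    show "Hausdorff_space (subtopology Y (Y closure_of (f ` A)))"
      using assms(2) by (rule Hausdorff_space_subtopology)
    show "continuous_map (subtopology X ?C) (subtopology Y (Y closure_of (f ` A))) f"
      using f image by (auto simp: continuous_map_in_subtopology)
    show "f ` topspace (subtopology X ?C) = topspace (subtopology Y (Y closure_of (f ` A)))"
      using image closure_of_subset_topspace[of X A] closure_of_subset_topspace[of Y "f ` A"]
      by (simp add: inf.absorb2)
    show "inj_on f (topspace (subtopology X ?C))"
      using inj by (rule inj_on_subset) auto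
  qed
  then show ?thesis
    by (rule homeomorphic_map_imp_homeomorphic_space)
qed

section \<open>Gibbs weights and the equations of their closure\<close>

definition gibbs :: "'a::real_inner set \<Rightarrow> 'a \<Rightarrow> 'a \<Rightarrow> real" where
  "gibbs V x = (\<lambda>w\<in>V. exp (w \<bullet> x) / (\<Sum>v\<in>V. exp (v \<bullet> x)))"

text \<open>The factors are the unit interval rather than the real line so that the whole space is compact and
powers with positive real exponents are continuous on each factor.\<close>

definition weight_cube :: "'a set \<Rightarrow> ('a \<Rightarrow> real) topology" where
  "weight_cube V = product_topology (\<lambda>_. top_of_set {0..1}) V"

definition gibbs_closure :: "'a::real_inner set \<Rightarrow> ('a \<Rightarrow> real) set" where
  "gibbs_closure V = weight_cube V closure_of range (gibbs V)"

definition mean :: "'a::real_vector set \<Rightarrow> ('a \<Rightarrow> real) \<Rightarrow> 'a" where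
  "mean V p = (\<Sum>w\<in>V. p w *\<^sub>R w)"

lemma compact_weight_cube: "compact_space (weight_cube V)"
  unfolding weight_cube_def compact_space_product_topology
  by (simp add: compact_space_subtopology)

lemma continuous_map_weight:
  assumes "w \<in> V" shows "continuous_map (weight_cube V) euclideanreal (\<lambda>p. p w)"
  using continuous_map_product_projection[OF assms, of "\<lambda>_. top_of_set {0..1::real}"]
  unfolding weight_cube_def continuous_map_in_subtopology by blast

lemma partition_function_pos:
  assumes "finite V" "V \<noteq> {}" shows "(\<Sum>v\<in>V. exp (v \<bullet> x)) > 0"
  using assms by (intro sum_pos) auto

lemma gibbs_nonneg: "w \<in> V \<Longrightarrow> 0 \<le> gibbs V x w"
  by (simp add: gibbs_def sum_nonneg)

lemma sum_gibbs:
  assumes "finite V" "V \<noteq> {}" shows "(\<Sum>w\<in>V. gibbs V x w) = 1"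
  using partition_function_pos[OF assms, of x]
  by (simp add: gibbs_def flip: sum_divide_distrib)

lemma gibbs_in_weight_cube:
  assumes "finite V" "V \<noteq> {}" shows "range (gibbs V) \<subseteq> topspace (weight_cube V)"
proof -
  have "gibbs V x w \<le> 1" if "w \<in> V" for x w
    using member_le_sum[OF that _ assms(1), of "gibbs V x"] gibbs_nonneg[of _ V x] sum_gibbs[OF assms]
    by auto
  then show ?thesis
    by (auto simp: weight_cube_def gibbs_nonneg) (simp add: gibbs_def)
qed

lemma gibbs_closure_subset: "gibbs_closure V \<subseteq> topspace (weight_cube V)"
  unfolding gibbs_closure_def by (rule closure_of_subset_topspace)

text \<open>Equations between continuous functions pass from the Gibbs weights to their closure; both the
normalisation and the binomial equations reach the boundary points in this way.\<close>

lemma gibbs_closure_equation: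
  assumes V: "finite V" "V \<noteq> {}" and "p \<in> gibbs_closure V"
    and "continuous_map (weight_cube V) euclideanreal f"
    and "continuous_map (weight_cube V) euclideanreal g"
    and "\<And>x. f (gibbs V x) = g (gibbs V x)"
  shows "f p = g p"
proof -
  have "gibbs_closure V \<subseteq> {p \<in> topspace (weight_cube V). f p = g p}"
    unfolding gibbs_closure_def
    using assms gibbs_in_weight_cube[OF V]
    by (intro closure_of_minimal closedin_continuous_maps_eq) auto
  then show ?thesis using assms(3) by blast
qed

lemma gibbs_closure_nonneg:
  assumes "p \<in> gibbs_closure V" "w \<in> V" shows "0 \<le> p w"
  using assms gibbs_closure_subset[of V] by (force simp: weight_cube_def)

lemma sum_gibbs_closure:
  assumes V: "finite V" "V \<noteq> {}" and "p \<in> gibbs_closure V" shows "sum p V = 1"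
proof (rule gibbs_closure_equation[OF assms, where f = "\<lambda>p. sum p V" and g = "\<lambda>_. 1"])
  show "continuous_map (weight_cube V) euclideanreal (\<lambda>p. sum p V)"
    using V(1) by (intro continuous_map_sum continuous_map_weight)
qed (simp_all add: sum_gibbs[OF V])

text \<open>The product depends on the exponents \<open>a\<close> only through their total and their weighted sum, so two
families of exponents that agree in both give equal products. The index set is restricted to positive
exponents because \<open>0 powr 0 = 0\<close>: at a vanishing weight a factor with exponent \<open>0\<close> would annihilate the
product instead of contributing \<open>1\<close>.\<close>

lemma gibbs_binomial:
  assumes V: "finite V" "V \<noteq> {}" and a: "\<And>w. w \<in> V \<Longrightarrow> 0 \<le> a w"
  shows "(\<Prod>w\<in>{w\<in>V. a w > 0}. gibbs V x w powr a w)
       = exp ((\<Sum>w\<in>V. a w *\<^sub>R w) \<bullet> x - sum a V * ln (\<Sum>v\<in>V. exp (v \<bullet> x)))"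
proof -
  let ?Z = "\<Sum>v\<in>V. exp (v \<bullet> x)"
  have "gibbs V x w powr a w = exp (a w * (w \<bullet> x - ln ?Z))" if "w \<in> V" for w
    using that partition_function_pos[OF V, of x]
    by (simp add: gibbs_def powr_def ln_div)
  then have "(\<Prod>w\<in>{w\<in>V. a w > 0}. gibbs V x w powr a w)
      = exp (\<Sum>w\<in>{w\<in>V. a w > 0}. a w * (w \<bullet> x - ln ?Z))"
    using V by (simp add: exp_sum)
  also have "(\<Sum>w\<in>{w\<in>V. a w > 0}. a w * (w \<bullet> x - ln ?Z)) = (\<Sum>w\<in>V. a w * (w \<bullet> x - ln ?Z))"
    using V a by (intro sum.mono_neutral_left) (auto simp: order.order_iff_strict)
  also have "\<dots> = (\<Sum>w\<in>V. a w *\<^sub>R w) \<bullet> x - sum a V * ln ?Z"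
    by (simp add: inner_sum_left right_diff_distrib sum_subtractf sum_distrib_right)
  finally show ?thesis .
qed

text \<open>The real-exponent analogue of the binomial equations that cut out a toric variety.\<close>

lemma gibbs_closure_binomial:
  assumes V: "finite V" "V \<noteq> {}" and p: "p \<in> gibbs_closure V"
    and a: "\<And>w. w \<in> V \<Longrightarrow> 0 \<le> a w" and b: "\<And>w. w \<in> V \<Longrightarrow> 0 \<le> b w"
    and "sum a V = sum b V" and "(\<Sum>w\<in>V. a w *\<^sub>R w) = (\<Sum>w\<in>V. b w *\<^sub>R w)"
  shows "(\<Prod>w\<in>{w\<in>V. a w > 0}. p w powr a w) = (\<Prod>w\<in>{w\<in>V. b w > 0}. p w powr b w)"
proof -
  have power: "continuous_map (weight_cube V) euclideanreal (\<lambda>p. p w powr c)"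
    if "w \<in> V" "0 < c" for w c
  proof -
    have "continuous_map (top_of_set {0..1}) euclideanreal (\<lambda>t::real. t powr c)"
      unfolding continuous_map_iff_continuous
      using \<open>0 < c\<close> by (intro continuous_on_powr' continuous_on_id continuous_on_const) auto
    from continuous_map_compose[OF continuous_map_product_projection[OF \<open>w \<in> V\<close>] this]
    show ?thesis by (simp add: weight_cube_def o_def)
  qed
  show ?thesis
  proof (rule gibbs_closure_equation[OF V p])
    show "continuous_map (weight_cube V) euclideanreal (\<lambda>p. \<Prod>w\<in>{w\<in>V. a w > 0}. p w powr a w)"
      using V by (intro continuous_map_prod power) auto
    show "continuous_map (weight_cube V) euclideanreal (\<lambda>p. \<Prod>w\<in>{w\<in>V. b w > 0}. p w powr b w)"
      using V by (intro continuous_map_prod power) auto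
  qed (simp only: gibbs_binomial[OF V a] gibbs_binomial[OF V b] assms)
qed

section \<open>The moment map\<close>

text \<open>If \<open>p\<close> and \<open>q\<close> have the same mean, then the positive part \<open>a\<close> and the negative part \<open>b\<close> of \<open>p - q\<close>
satisfy the hypotheses of the binomial equation. Where \<open>a\<close> is positive \<open>p\<close> exceeds \<open>q\<close>, and where \<open>b\<close>
is positive \<open>q\<close> exceeds \<open>p\<close>; so passing from \<open>p\<close> to \<open>q\<close> would strictly decrease one side of the equation
and not decrease the other.\<close>

lemma inj_on_mean_gibbs_closure:
  assumes V: "finite V" "V \<noteq> {}"
  shows "inj_on (mean V) (gibbs_closure V)"
proof (rule inj_onI, rule ccontr)
  fix p q
  assume p: "p \<in> gibbs_closure V" and q: "q \<in> gibbs_closure V"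
    and mean: "mean V p = mean V q" and "p \<noteq> q"
  define a where "a w = max 0 (p w - q w)" for w
  define b where "b w = max 0 (q w - p w)" for w
  have diff: "a w = b w + p w - q w" for w
    by (simp add: a_def b_def)
  have sums: "sum a V = sum b V" "(\<Sum>w\<in>V. a w *\<^sub>R w) = (\<Sum>w\<in>V. b w *\<^sub>R w)"
    using sum_gibbs_closure[OF V p] sum_gibbs_closure[OF V q] mean
    by (simp_all add: diff sum.distrib sum_subtractf scaleR_diff_left scaleR_add_left mean_def)
  have rel: "(\<Prod>w\<in>{w\<in>V. a w > 0}. r w powr a w) = (\<Prod>w\<in>{w\<in>V. b w > 0}. r w powr b w)"
    if "r \<in> gibbs_closure V" for r
    using that sums by (intro gibbs_closure_binomial[OF V]) (auto simp: a_def b_def)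
  have nonneg: "0 \<le> p w" "0 \<le> q w" if "w \<in> V" for w
    using that p q by (auto intro: gibbs_closure_nonneg)
  have "\<exists>w\<in>V. a w > 0"
  proof (rule ccontr)
    assume "\<not> (\<exists>w\<in>V. a w > 0)"
    then have le: "p w \<le> q w" if "w \<in> V" for w using that by (force simp: a_def)
    have "p w = q w" if "w \<in> V" for w
      using sum_mono_inv[of p V q w] le that V
      by (simp add: sum_gibbs_closure[OF V p] sum_gibbs_closure[OF V q])
    moreover have "p \<in> extensional V" "q \<in> extensional V"
      using p q gibbs_closure_subset[of V] by (auto simp: weight_cube_def PiE_def)
    ultimately show False using \<open>p \<noteq> q\<close> extensionalityI by blast
  qed
  then obtain v where v: "v \<in> V" "a v > 0" by blast
  have less: "q w powr a w < p w powr a w" if "w \<in> V" "a w > 0" for w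
    using that nonneg by (intro powr_less_mono2) (auto simp: a_def)
  have "(\<Prod>w\<in>{w\<in>V. a w > 0}. q w powr a w) < (\<Prod>w\<in>{w\<in>V. a w > 0}. p w powr a w)"
  proof (rule prod_mono_strict[of v])
    show "0 \<le> q w powr a w \<and> q w powr a w \<le> p w powr a w" if "w \<in> {w\<in>V. a w > 0}" for w
      using less[of w] that by simp
    show "0 < p w powr a w" if "w \<in> {w\<in>V. a w > 0}" for w
      using le_less_trans[OF powr_ge_zero less[of w]] that by blast
  qed (use v V less[OF v] in simp_all)
  also have "\<dots> = (\<Prod>w\<in>{w\<in>V. b w > 0}. p w powr b w)"
    by (rule rel[OF p])
  also have "\<dots> \<le> (\<Prod>w\<in>{w\<in>V. b w > 0}. q w powr b w)"
    using nonneg by (intro prod_mono) (auto simp: b_def intro!: powr_mono2)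
  also have "\<dots> = (\<Prod>w\<in>{w\<in>V. a w > 0}. q w powr a w)"
    by (rule rel[OF q, symmetric])
  finally show False by simp
qed

text \<open>A linear functional attains its maximum over a convex hull at one of the generating points.\<close>

lemma exists_generator_above:
  fixes V :: "'a::real_inner set"
  assumes "finite V" "y \<in> convex hull V"
  shows "\<exists>v\<in>V. y \<bullet> x \<le> v \<bullet> x"
proof (rule ccontr)
  assume "\<not> ?thesis"
  then have "convex hull V \<subseteq> {v. x \<bullet> v < x \<bullet> y}"
    by (intro hull_minimal convex_halfspace_lt) (auto simp: inner_commute)
  then show False using assms(2) by blast
qed

text \<open>The function \<open>G x = (\<Sum>v\<in>V. exp ((v - q) \<bullet> x))\<close> is coercive precisely because \<open>q\<close> is an interior point:
in each direction some \<open>v - q\<close> has a component bounded away from \<open>0\<close>. Its gradient vanishes at a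
minimiser \<open>x\<close>, which says that the Gibbs weights at \<open>x\<close> have mean \<open>q\<close>.\<close>

lemma interior_hull_subset_gibbs_means:
  fixes V :: "'a::euclidean_space set"
  assumes V: "finite V"
  shows "interior (convex hull V) \<subseteq> range (\<lambda>x. mean V (gibbs V x))"
proof
  fix q assume q: "q \<in> interior (convex hull V)"
  then have "V \<noteq> {}" by auto
  obtain r where r: "r > 0" "cball q r \<subseteq> convex hull V"
    using q by (auto simp: mem_interior_cball)
  define G where "G x = (\<Sum>v\<in>V. exp ((v - q) \<bullet> x))" for x
  have G_ge: "r * norm x \<le> G x" for x
  proof (cases "x = 0")
    case False
    have "q + (r / norm x) *\<^sub>R x \<in> cball q r"
      using r(1) False by (simp add: dist_norm)
    then obtain v where v: "v \<in> V" "(q + (r / norm x) *\<^sub>R x) \<bullet> x \<le> v \<bullet> x"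
      using exists_generator_above[OF V] r(2) by blast
    have "r * norm x \<le> (v - q) \<bullet> x"
      using v(2) False by (simp add: inner_add_left inner_diff_left dot_square_norm power2_eq_square)
    also have "\<dots> \<le> exp ((v - q) \<bullet> x)"
      using exp_ge_add_one_self[of "(v - q) \<bullet> x"] by linarith
    also have "\<dots> \<le> G x"
      unfolding G_def using v(1) V by (intro member_le_sum) auto
    finally show ?thesis .
  qed (simp add: G_def)
  have cont: "continuous_on A G" for A
    unfolding G_def by (intro continuous_intros)
  \<comment> \<open>Outside the ball of radius \<open>R\<close> the lower bound already exceeds \<open>G 0\<close>.\<close>
  define R where "R = G 0 / r"
  have "0 \<le> R" using r(1) by (simp add: R_def G_def)
  obtain x where x: "x \<in> cball 0 R" "\<And>y. y \<in> cball 0 R \<Longrightarrow> G x \<le> G y"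
    using continuous_attains_inf[OF compact_cball _ cont, of 0 R] \<open>0 \<le> R\<close> by auto
  have min: "G x \<le> G y" for y
  proof (cases "y \<in> cball 0 R")
    case False
    then have "G 0 \<le> r * norm y"
      using r(1) by (simp add: R_def divide_le_eq mult.commute not_le less_imp_le divide_less_eq)
    then show ?thesis
      using G_ge[of y] x(2)[of 0] \<open>0 \<le> R\<close> by simp
  qed (use x(2) in blast)
  have "(G has_derivative (\<lambda>h. \<Sum>v\<in>V. ((v - q) \<bullet> h) * exp ((v - q) \<bullet> x))) (at x)"
    unfolding G_def by (auto intro!: derivative_eq_intros sum.cong)
  from differential_zero_maxmin[OF UNIV_I open_UNIV this] min
  have zero: "(\<Sum>v\<in>V. ((v - q) \<bullet> h) * exp ((v - q) \<bullet> x)) = 0" for h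
    by (metis (no_types, lifting))
  let ?Z = "\<Sum>v\<in>V. exp (v \<bullet> x)"
  have "(\<Sum>v\<in>V. exp (v \<bullet> x) *\<^sub>R (v - q)) \<bullet> h = 0" for h
  proof -
    have "(\<Sum>v\<in>V. exp (v \<bullet> x) *\<^sub>R (v - q)) \<bullet> h
        = exp (q \<bullet> x) * (\<Sum>v\<in>V. ((v - q) \<bullet> h) * exp ((v - q) \<bullet> x))"
      by (simp add: inner_sum_left sum_distrib_left inner_diff_left exp_diff mult.commute)
    then show ?thesis by (simp add: zero)
  qed
  then have "(\<Sum>v\<in>V. exp (v \<bullet> x) *\<^sub>R (v - q)) = 0"
    using inner_eq_zero_iff by blast
  then have "(\<Sum>v\<in>V. exp (v \<bullet> x) *\<^sub>R v) = ?Z *\<^sub>R q"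
    by (simp add: scaleR_diff_right sum_subtractf scaleR_sum_left)
  moreover have "mean V (gibbs V x) = (1 / ?Z) *\<^sub>R (\<Sum>v\<in>V. exp (v \<bullet> x) *\<^sub>R v)"
    by (simp add: mean_def gibbs_def scaleR_sum_right)
  ultimately have "mean V (gibbs V x) = q"
    using partition_function_pos[OF V \<open>V \<noteq> {}\<close>, of x] by simp
  then show "q \<in> range (\<lambda>x. mean V (gibbs V x))" by blast
qed

lemma closure_gibbs_means:
  fixes V :: "'a::euclidean_space set"
  assumes V: "finite V" and int: "interior (convex hull V) \<noteq> {}"
  shows "closure (mean V ` range (gibbs V)) = convex hull V"
proof
  have "V \<noteq> {}" using int by auto
  have closed: "closed (convex hull V)"
    using V by (simp add: finite_imp_compact_convex_hull compact_imp_closed)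
  have "mean V (gibbs V x) \<in> convex hull V" for x
    unfolding mean_def using V \<open>V \<noteq> {}\<close>
    by (intro convex_sum) (auto simp: sum_gibbs gibbs_nonneg hull_inc)
  then show "closure (mean V ` range (gibbs V)) \<subseteq> convex hull V"
    using closed by (intro closure_minimal) auto
  have "convex hull V = closure (interior (convex hull V))"
    using closed int by (simp add: convex_closure_interior)
  also have "\<dots> \<subseteq> closure (mean V ` range (gibbs V))"
    using interior_hull_subset_gibbs_means[OF V] by (intro closure_mono) auto
  finally show "convex hull V \<subseteq> closure (mean V ` range (gibbs V))" .
qed

lemma gibbs_closure_homeomorphic_hull:
  fixes V :: "'a::euclidean_space set"
  assumes V: "finite V" and int: "interior (convex hull V) \<noteq> {}"
  shows "subtopology (weight_cube V) (gibbs_closure V) homeomorphic_space top_of_set (convex hull V)"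
proof -
  have "V \<noteq> {}" using int by auto
  have "continuous_map (weight_cube V) euclidean (\<lambda>p. p w *\<^sub>R w)" if "w \<in> V" for w
  proof -
    have "continuous_map euclideanreal euclidean (\<lambda>t. t *\<^sub>R w)"
      by (simp add: continuous_intros)
    from continuous_map_compose[OF continuous_map_weight[OF that] this]
    show ?thesis by (simp add: o_def)
  qed
  then have "continuous_map (weight_cube V) euclidean (mean V)"
    unfolding mean_def[abs_def] using V by (intro continuous_map_sum)
  then have "subtopology (weight_cube V) (gibbs_closure V)
      homeomorphic_space subtopology euclidean (euclidean closure_of (mean V ` range (gibbs V)))"
    unfolding gibbs_closure_def
    using V \<open>V \<noteq> {}\<close> inj_on_mean_gibbs_closure[OF V \<open>V \<noteq> {}\<close>, unfolded gibbs_closure_def]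
    by (intro closure_homeomorphic_to_closure_of_image[OF compact_weight_cube]
          gibbs_in_weight_cube Hausdorff_space_euclidean continuous_map_from_subtopology)
  then show ?thesis
    by (simp only: euclidean_closure_of closure_gibbs_means[OF V int])
qed

section \<open>The map to horofunctions\<close>

definition max_weight :: "'a::real_inner set \<Rightarrow> ('a \<Rightarrow> real) \<Rightarrow> 'a \<Rightarrow> real" where
  "max_weight V p z = (MAX w\<in>V. p w * exp (w \<bullet> z))"

text \<open>Rescaling \<open>p\<close> leaves this function unchanged, so the weights may be normalised by their sum,
as the moment map requires, although horofunctions are normalised by their value at \<open>0\<close>.\<close>

definition log_profile :: "'a::real_inner set \<Rightarrow> ('a \<Rightarrow> real) \<Rightarrow> 'a \<Rightarrow> real" where
  "log_profile V p z = ln (max_weight V p z) - ln (max_weight V p 0)"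

lemma continuous_map_Max:
  fixes f :: "'i \<Rightarrow> 'a \<Rightarrow> real"
  assumes "finite I" "I \<noteq> {}" "\<And>i. i \<in> I \<Longrightarrow> continuous_map X euclideanreal (f i)"
  shows "continuous_map X euclideanreal (\<lambda>x. MAX i\<in>I. f i x)"
  using assms
proof (induction I rule: finite_ne_induct)
  case (insert i I)
  then show ?case
    by (simp add: continuous_map_real_max)
qed simp

lemma continuous_map_max_weight:
  assumes "finite V" "V \<noteq> {}"
  shows "continuous_map (prod_topology (weight_cube V) euclidean) euclideanreal
           (\<lambda>x. max_weight V (fst x) (snd x))"
  unfolding max_weight_def
proof (intro continuous_map_Max assms continuous_map_real_mult)
  fix w assume w: "w \<in> V"
  show "continuous_map (prod_topology (weight_cube V) euclidean) euclideanreal (\<lambda>x. fst x w)"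
    using continuous_map_compose[OF continuous_map_fst continuous_map_weight[OF w]]
    by (simp add: o_def)
  have "continuous_map euclidean euclideanreal (\<lambda>z. exp (w \<bullet> z))"
    by (simp add: continuous_intros)
  from continuous_map_compose[OF continuous_map_snd this]
  show "continuous_map (prod_topology (weight_cube V) euclidean) euclideanreal (\<lambda>x. exp (w \<bullet> snd x))"
    by (simp add: o_def)
qed

text \<open>Some weight stays positive on the closure because the weights still sum to \<open>1\<close>; hence the logarithm
is finite and continuous even where individual weights vanish.\<close>

lemma max_weight_pos:
  assumes V: "finite V" "V \<noteq> {}" and p: "p \<in> gibbs_closure V"
  shows "max_weight V p z > 0"
proof -
  have "\<exists>w\<in>V. p w > 0"
  proof (rule ccontr)
    assume "\<not> ?thesis"
    then have "sum p V \<le> 0" by (intro sum_nonpos) force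
    then show False by (simp add: sum_gibbs_closure[OF assms])
  qed
  then have "\<exists>w\<in>V. 0 < p w * exp (w \<bullet> z)"
    by (metis exp_gt_zero mult_pos_pos)
  then show ?thesis
    unfolding max_weight_def using V by (simp add: Max_gr_iff)
qed

lemma continuous_map_log_profile:
  assumes V: "finite V" "V \<noteq> {}"
  shows "continuous_map (subtopology (weight_cube V) (gibbs_closure V)) compact_open_topology
           (log_profile V)"
proof (rule continuous_map_into_compact_open_topology)
  let ?X = "subtopology (weight_cube V) (gibbs_closure V)"
  let ?XE = "prod_topology ?X (euclidean :: 'a topology)"
  have ln: "continuous_map (top_of_set {0<..}) euclideanreal (ln :: real \<Rightarrow> real)"
    by (auto intro!: continuous_intros)
  have ln_max: "continuous_map Y euclideanreal (\<lambda>y. ln (max_weight V (f y) (g y)))"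
    if f: "continuous_map Y ?X f" and g: "continuous_map Y euclidean g" for Y :: "'b topology" and f g
  proof -
    have f': "continuous_map Y (weight_cube V) f"
      using f by (simp add: continuous_map_in_subtopology)
    have "continuous_map Y euclideanreal (\<lambda>y. max_weight V (f y) (g y))"
      using continuous_map_compose[OF continuous_map_pairedI[OF f' g] continuous_map_max_weight[OF V]]
      by (simp add: o_def)
    moreover have "f y \<in> gibbs_closure V" if "y \<in> topspace Y" for y
      using f that by (auto simp: continuous_map_in_subtopology)
    ultimately have "continuous_map Y (top_of_set {0<..}) (\<lambda>y. max_weight V (f y) (g y))"
      using max_weight_pos[OF V] by (auto simp: continuous_map_in_subtopology)
    from continuous_map_compose[OF this ln] show ?thesis by (simp add: o_def)
  qed
  show "continuous_map ?XE euclideanreal (\<lambda>(p, z). log_profile V p z)"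
    unfolding log_profile_def case_prod_unfold
    by (intro continuous_map_diff ln_max continuous_map_fst continuous_map_snd) auto
qed

lemma tendsto_Max_image:
  fixes f :: "'i \<Rightarrow> 'a \<Rightarrow> real"
  assumes "finite I" "I \<noteq> {}" "\<And>i. i \<in> I \<Longrightarrow> (f i \<longlongrightarrow> l i) F"
  shows "((\<lambda>x. MAX i\<in>I. f i x) \<longlongrightarrow> (MAX i\<in>I. l i)) F"
  using assms
proof (induction I rule: finite_ne_induct)
  case (insert i I)
  then show ?case
    by (simp add: tendsto_max)
qed simp

text \<open>When \<open>u\<close> exposes \<open>v\<close>, every other term of the maximum is exponentially smaller than the term of \<open>v\<close>
along the ray through \<open>u\<close>, so the rescaled maximum isolates \<open>p v\<close>, also when \<open>p v = 0\<close>.\<close>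

lemma max_weight_ray_tendsto:
  assumes V: "finite V" "v \<in> V" and "0 \<le> p v"
    and u: "\<And>w. w \<in> V - {v} \<Longrightarrow> w \<bullet> u < v \<bullet> u"
  shows "((\<lambda>t. max_weight V p (t *\<^sub>R u) * exp (- t * (v \<bullet> u))) \<longlongrightarrow> p v) at_top"
proof -
  have eq: "max_weight V p (t *\<^sub>R u) * exp (- t * (v \<bullet> u))
      = (MAX w\<in>V. p w * exp (t * (w \<bullet> u - v \<bullet> u)))" for t
  proof -
    have "mono (\<lambda>s. s * exp (- t * (v \<bullet> u)))" 
      by (auto intro!: monoI)
    from mono_Max_commute[OF this, of "(\<lambda>w. p w * exp (w \<bullet> t *\<^sub>R u)) ` V"] 
    show ?thesis using V
      by (auto simp: max_weight_def image_image algebra_simps simp flip: exp_add)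
  qed
  have "((\<lambda>t. p w * exp (t * (w \<bullet> u - v \<bullet> u))) \<longlongrightarrow> (if w = v then p v else 0)) at_top"
    if "w \<in> V" for w
  proof (cases "w = v")
    case False
    then have "w \<bullet> u - v \<bullet> u < 0" using u that by auto
    then have "filterlim (\<lambda>t. t * (w \<bullet> u - v \<bullet> u)) at_bot at_top"
      by (intro filterlim_tendsto_neg_mult_at_bot[OF tendsto_const _ filterlim_ident, simplified mult.commute])
    from tendsto_mult_left[OF filterlim_compose[OF exp_at_bot this], of "p w"] False show ?thesis
      by simp
  qed simp
  then have "((\<lambda>t. MAX w\<in>V. p w * exp (t * (w \<bullet> u - v \<bullet> u))) \<longlongrightarrow>
      (MAX w\<in>V. if w = v then p v else 0)) at_top"
    using V by (intro tendsto_Max_image) auto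
  moreover have "(MAX w\<in>V. if w = v then p v else 0) = p v"
    using V \<open>0 \<le> p v\<close> by (intro Max_eqI) auto
  ultimately show ?thesis unfolding eq by (simp only:)
qed

text \<open>Equal profiles mean that the two maxima are proportional. Each \<open>v\<close> can be separated from the hull of
the other points, which gives a direction exposing \<open>v\<close>; comparing growth along it shows that the weights
are proportional, and their sums make the factor \<open>1\<close>.\<close>

lemma inj_on_log_profile:
  fixes V :: "'a::euclidean_space set"
  assumes V: "finite V" "V \<noteq> {}" and indep: "\<And>v. v \<in> V \<Longrightarrow> v \<notin> convex hull (V - {v})"
  shows "inj_on (log_profile V) (gibbs_closure V)"
proof (rule inj_onI)
  fix p q
  assume p: "p \<in> gibbs_closure V" and q: "q \<in> gibbs_closure V"
    and eq: "log_profile V p = log_profile V q"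
  define c where "c = max_weight V p 0 / max_weight V q 0"
  have scaled: "max_weight V p z = c * max_weight V q z" for z
  proof -
    have "ln (max_weight V p z) - ln (max_weight V p 0) = ln (max_weight V q z) - ln (max_weight V q 0)"
      using fun_cong[OF eq, of z] by (simp add: log_profile_def)
    then have "ln (max_weight V p z / max_weight V p 0) = ln (max_weight V q z / max_weight V q 0)"
      using max_weight_pos[OF V p, of z] max_weight_pos[OF V p, of 0]
        max_weight_pos[OF V q, of z] max_weight_pos[OF V q, of 0] by (simp add: ln_div)
    then have "max_weight V p z / max_weight V p 0 = max_weight V q z / max_weight V q 0"
      using max_weight_pos[OF V p, of z] max_weight_pos[OF V p, of 0]
        max_weight_pos[OF V q, of z] max_weight_pos[OF V q, of 0] by simp
    then show ?thesis
      using max_weight_pos[OF V p, of 0] by (simp add: c_def field_simps)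
  qed
  have weights: "p v = c * q v" if v: "v \<in> V" for v
  proof -
    have "\<exists>u b. u \<bullet> v < b \<and> (\<forall>w\<in>convex hull (V - {v}). b < u \<bullet> w)"
      using V indep[OF v]
      by (intro separating_hyperplane_closed_point)
         (auto simp: finite_imp_compact_convex_hull compact_imp_closed)
    then obtain u b where "u \<bullet> v < b" "\<And>w. w \<in> V - {v} \<Longrightarrow> b < u \<bullet> w"
      by (metis hull_inc)
    then have u: "w \<bullet> (- u) < v \<bullet> (- u)" if "w \<in> V - {v}" for w
      using that by (fastforce simp: inner_commute)
    have "((\<lambda>t. max_weight V p (t *\<^sub>R (- u)) * exp (- t * (v \<bullet> (- u)))) \<longlongrightarrow> c * q v) at_top"
      unfolding scaled mult.assoc
      using q v V u by (intro tendsto_mult_left max_weight_ray_tendsto gibbs_closure_nonneg) auto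
    moreover have "((\<lambda>t. max_weight V p (t *\<^sub>R (- u)) * exp (- t * (v \<bullet> (- u)))) \<longlongrightarrow> p v) at_top"
      using p v V u by (intro max_weight_ray_tendsto gibbs_closure_nonneg) auto
    ultimately show ?thesis
      using tendsto_unique trivial_limit_at_top_linorder by blast
  qed
  have "sum p V = c * sum q V"
    by (simp add: weights sum_distrib_left)
  then have "c = 1"
    by (simp add: sum_gibbs_closure[OF V p] sum_gibbs_closure[OF V q])
  then have "p v = q v" if "v \<in> V" for v using weights[OF that] by simp
  moreover have "p \<in> extensional V" "q \<in> extensional V"
    using p q gibbs_closure_subset[of V] by (auto simp: weight_cube_def PiE_def)
  ultimately show "p = q" using extensionalityI by blast
qed

text \<open>The exponential is monotone and turns the maximum defining \<open>N (x - z)\<close> into a maximum of Gibbs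
weights; the partition function contributes a constant that cancels in the difference. The sign of \<open>x\<close> is
due to the lower bound \<open>-1\<close> in the polar set.\<close>

lemma log_profile_gibbs:
  assumes V: "finite V" "V \<noteq> {}" and N: "\<And>x. N x = (MAX w\<in>V. - (w \<bullet> x))"
  shows "log_profile V (gibbs V (- x)) = horofunction_embedding N x"
proof
  fix z
  let ?Z = "\<Sum>v\<in>V. exp (v \<bullet> (- x))"
  have Z: "?Z > 0" by (rule partition_function_pos[OF V])
  have "max_weight V (gibbs V (- x)) y = exp (N (x - y) - ln ?Z)" for y
  proof -
    have "mono (\<lambda>s::real. exp (s - ln ?Z))" by (auto intro!: monoI)
    from mono_Max_commute[OF this, of "(\<lambda>w. - (w \<bullet> (x - y))) ` V"]
    have "exp (N (x - y) - ln ?Z) = (MAX w\<in>V. exp (- (w \<bullet> (x - y)) - ln ?Z))"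
      using V by (simp add: N image_image)
    also have "\<dots> = max_weight V (gibbs V (- x)) y"
      unfolding max_weight_def using exp_ln[OF Z]
      by (intro arg_cong[where f = Max] image_cong)
         (simp_all add: gibbs_def exp_diff inner_diff_right flip: exp_add)
    finally show ?thesis ..
  qed
  then show "log_profile V (gibbs V (- x)) z = horofunction_embedding N x z"
    by (simp add: log_profile_def horofunction_embedding_def norm_dist_def)
qed


section \<open>Polar duality for polyhedral norms\<close>

lemma asymmetric_norm_zero: "asymmetric_norm N \<Longrightarrow> N 0 = 0"
  unfolding asymmetric_norm_def by (metis mult_zero_left order_refl scaleR_zero_left)

lemma continuous_asymmetric_norm:
  fixes N :: "'a::euclidean_space \<Rightarrow> real"
  assumes "asymmetric_norm N"
  shows "continuous_on UNIV N"
proof (rule convex_on_continuous)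
  show "convex_on UNIV N"
  proof (rule convex_onI)
    fix t :: real and x y
    assume "0 < t" "t < 1"
    then have "N ((1 - t) *\<^sub>R x) = (1 - t) * N x" "N (t *\<^sub>R y) = t * N y"
      using assms by (simp_all add: asymmetric_norm_def)
    then show "N ((1 - t) *\<^sub>R x + t *\<^sub>R y) \<le> (1 - t) * N x + t * N y"
      using assms by (metis asymmetric_norm_def)
  qed simp
qed simp

lemma zero_in_interior_unit_ball:
  fixes N :: "'a::euclidean_space \<Rightarrow> real"
  assumes "asymmetric_norm N"
  shows "0 \<in> interior (unit_ball N)"
proof (rule interiorI)
  show "open {x. N x < 1}"
    by (intro open_Collect_less continuous_asymmetric_norm assms continuous_on_const)
qed (use asymmetric_norm_zero[OF assms] in \<open>auto simp: unit_ball_def\<close>)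

lemma bounded_polar_set:
  fixes P :: "'a::euclidean_space set"
  assumes "0 \<in> interior P"
  shows "bounded (polar_set P)"
proof -
  obtain r where r: "r > 0" "cball 0 r \<subseteq> P"
    using assms by (auto simp: mem_interior_cball)
  have "norm v \<le> 1 / r" if "v \<in> polar_set P" for v
  proof (cases "v = 0")
    case False
    have "(- (r / norm v)) *\<^sub>R v \<in> P"
      using r False by (intro subsetD[OF r(2)]) simp
    then have "- 1 \<le> v \<bullet> ((- (r / norm v)) *\<^sub>R v)"
      using that unfolding polar_set_def by blast
    also have "\<dots> = - (r * norm v)"
      using False by (simp add: dot_square_norm power2_eq_square)
    finally show ?thesis using r(1) by (simp add: field_simps)
  qed (use r in simp)
  then show ?thesis by (rule boundedI)
qed

lemma zero_in_interior_polar_set: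
  fixes P :: "'a::euclidean_space set"
  assumes "bounded P"
  shows "0 \<in> interior (polar_set P)"
proof -
  obtain B where B: "B > 0" "\<And>u. u \<in> P \<Longrightarrow> norm u \<le> B"
    using assms by (auto simp: bounded_pos)
  have "cball 0 (1 / B) \<subseteq> polar_set P"
  proof
    fix v :: 'a assume v: "v \<in> cball 0 (1 / B)"
    have "- 1 \<le> v \<bullet> u" if "u \<in> P" for u
    proof -
      have "\<bar>v \<bullet> u\<bar> \<le> norm v * norm u" by (rule Cauchy_Schwarz_ineq2)
      also have "\<dots> \<le> 1 / B * B"
        using v B that by (intro mult_mono) auto
      finally show ?thesis using B(1) by simp
    qed
    then show "v \<in> polar_set P" by (simp add: polar_set_def)
  qed
  then show ?thesis
    using B(1) unfolding mem_interior_cball by (intro exI[of _ "1 / B"]) simp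
qed

text \<open>The inequalities for the finitely many generators of \<open>P\<close> imply those for all of \<open>P\<close>.\<close>

lemma polyhedron_polar_set:
  fixes P :: "'a::euclidean_space set"
  assumes "polytope P"
  shows "polyhedron (polar_set P)"
proof -
  obtain S where S: "finite S" "P = convex hull S"
    using assms by (auto simp: polytope_def)
  have "(\<forall>u\<in>convex hull S. v \<bullet> u \<ge> -1) \<longleftrightarrow> (\<forall>u\<in>S. v \<bullet> u \<ge> -1)" for v
    using hull_minimal[of S "{u. v \<bullet> u \<ge> -1}" convex] hull_subset[of S convex]
      convex_halfspace_ge[of "-1" v] by blast
  then have "polar_set P = \<Inter> ((\<lambda>u. {v. u \<bullet> v \<ge> -1}) ` S)"
    unfolding polar_set_def S(2) by (auto simp: inner_commute)
  then show ?thesis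
    using S(1) by (auto intro!: polyhedron_Inter polyhedron_halfspace_ge)
qed

lemma polytope_polar_unit_ball:
  fixes N :: "'a::euclidean_space \<Rightarrow> real"
  assumes "polyhedral_norm N"
  shows "polytope (polar_set (unit_ball N))"
  using assms
  by (simp add: polyhedral_norm_def polytope_eq_bounded_polyhedron[of "polar_set _"]
      polyhedron_polar_set bounded_polar_set zero_in_interior_unit_ball)

lemma asymmetric_norm_ge_polar:
  assumes N: "asymmetric_norm N" and "w \<in> polar_set (unit_ball N)"
  shows "- (w \<bullet> x) \<le> N x"
proof (cases "x = 0")
  case False
  then have pos: "N x > 0"
    using N by (metis asymmetric_norm_def order.order_iff_strict)
  then have "N ((1 / N x) *\<^sub>R x) = (1 / N x) * N x"
    using N unfolding asymmetric_norm_def by (metis divide_nonneg_nonneg less_imp_le zero_le_one)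
  then have "(1 / N x) *\<^sub>R x \<in> unit_ball N"
    using pos by (simp add: unit_ball_def)
  then have "- 1 \<le> w \<bullet> ((1 / N x) *\<^sub>R x)"
    using assms(2) unfolding polar_set_def by blast
  then show ?thesis using pos by (simp add: field_simps)
qed (simp add: asymmetric_norm_zero[OF N])

text \<open>The bipolar argument: if \<open>s < N x\<close> then \<open>x / s\<close> lies outside the unit ball, and a hyperplane separating
the two, rescaled so that its level is \<open>-1\<close>, is a point of the polar set.\<close>

lemma polar_functional_above:
  fixes N :: "'a::euclidean_space \<Rightarrow> real"
  assumes N: "asymmetric_norm N" and P: "convex (unit_ball N)" "closed (unit_ball N)"
    and s: "0 < s" "s < N x"
  shows "\<exists>v\<in>polar_set (unit_ball N). s < - (v \<bullet> x)"
proof -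
  have "N ((1 / s) *\<^sub>R x) = (1 / s) * N x"
    using N s(1) unfolding asymmetric_norm_def by (metis divide_nonneg_nonneg less_imp_le zero_le_one)
  then have "(1 / s) *\<^sub>R x \<notin> unit_ball N"
    using s by (simp add: unit_ball_def)
  then obtain a b where ab: "a \<bullet> ((1 / s) *\<^sub>R x) < b" "\<And>y. y \<in> unit_ball N \<Longrightarrow> b < a \<bullet> y"
    using separating_hyperplane_closed_point[OF P] by blast
  \<comment> \<open>The origin lies in the unit ball, so the separating level is negative.\<close>
  have "b < 0"
    using ab(2)[of 0] by (simp add: unit_ball_def asymmetric_norm_zero[OF N])
  have "(1 / - b) *\<^sub>R a \<in> polar_set (unit_ball N)"
    using ab(2) \<open>b < 0\<close> by (force simp: polar_set_def field_simps)
  moreover have "s < - (((1 / - b) *\<^sub>R a) \<bullet> x)"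
    using ab(1) \<open>b < 0\<close> s(1) by (simp add: field_simps)
  ultimately show ?thesis by blast
qed

lemma polyhedral_norm_eq_Max_vertices:
  fixes N :: "'a::euclidean_space \<Rightarrow> real"
  assumes "polyhedral_norm N" and V: "finite V" "V \<noteq> {}"
    and hull: "polar_set (unit_ball N) = convex hull V"
  shows "N x = (MAX w\<in>V. - (w \<bullet> x))"
proof (rule antisym)
  have N: "asymmetric_norm N" and P: "polytope (unit_ball N)"
    using assms(1) by (auto simp: polyhedral_norm_def)
  show "(MAX w\<in>V. - (w \<bullet> x)) \<le> N x"
    using V asymmetric_norm_ge_polar[OF N] hull by (auto simp: hull_inc)
  show "N x \<le> (MAX w\<in>V. - (w \<bullet> x))"
  proof (cases "x = 0")
    case True
    then show ?thesis using V by (simp add: asymmetric_norm_zero[OF N] image_constant_conv)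
  next
    case False
    then have "0 < N x"
      using N by (metis asymmetric_norm_def order.order_iff_strict)
    then show ?thesis
    proof (rule dense_le_bounded)
      fix s assume "0 < s" "s < N x"
      then obtain v where v: "v \<in> convex hull V" "s < - (v \<bullet> x)"
        using polar_functional_above[OF N] P polytope_imp_convex polytope_imp_closed hull by metis
      obtain w where "w \<in> V" "v \<bullet> (- x) \<le> w \<bullet> (- x)"
        using exists_generator_above[OF V(1) v(1)] by blast
      then show "s \<le> (MAX w\<in>V. - (w \<bullet> x))"
        using V v(2) by (subst Max_ge_iff) (auto intro!: bexI[of _ w])
    qed
  qed
qed

section \<open>The horofunction compactification and the polar polytope\<close>

theorem horofunction_compactification_homeomorphic_polar:
  fixes N :: "'a::euclidean_space \<Rightarrow> real"
  assumes N: "polyhedral_norm N"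
  shows "horofunction_compactification N homeomorphic_space
           top_of_set (polar_set (unit_ball N))"
proof -
  let ?K = "polar_set (unit_ball N)"
  define V where "V = {v. v extreme_point_of ?K}"
  have K: "polytope ?K"
    by (rule polytope_polar_unit_ball[OF N])
  have hull: "?K = convex hull V"
    unfolding V_def using K polytope_imp_compact polytope_imp_convex by (intro Krein_Milman_Minkowski)
  have fin: "finite V"
    unfolding V_def by (intro finite_polyhedron_extreme_points polytope_imp_polyhedron K)
  have int: "interior (convex hull V) \<noteq> {}"
    using zero_in_interior_polar_set[of "unit_ball N"] N polytope_imp_bounded hull
    by (auto simp: polyhedral_norm_def)
  then have ne: "V \<noteq> {}" by auto
  \<comment> \<open>Removing an extreme point leaves a convex set, which contains the hull of the other vertices.\<close>
  have indep: "v \<notin> convex hull (V - {v})" if "v \<in> V" for v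
  proof -
    have "convex (?K - {v})"
      using that by (simp add: V_def extreme_point_of_stillconvex polytope_imp_convex K)
    moreover have "V - {v} \<subseteq> ?K - {v}"
      by (auto simp: V_def extreme_point_of_def)
    ultimately have "convex hull (V - {v}) \<subseteq> ?K - {v}"
      by (intro hull_minimal)
    then show ?thesis by blast
  qed
  have "log_profile V (gibbs V (- x)) = horofunction_embedding N x" for x
    using fin ne polyhedral_norm_eq_Max_vertices[OF N fin ne hull] by (rule log_profile_gibbs)
  moreover have "range (gibbs V) = range (\<lambda>x. gibbs V (- x))"
    using surj_uminus by (metis image_image)
  ultimately have range: "log_profile V ` range (gibbs V) = range (horofunction_embedding N)"
    by (simp add: image_image)
  have "subtopology (weight_cube V) (gibbs_closure V) homeomorphic_space
      horofunction_compactification N"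
    unfolding horofunction_compactification_def range[symmetric] gibbs_closure_def
    by (intro closure_homeomorphic_to_closure_of_image compact_weight_cube
          Hausdorff_compact_open_topology gibbs_in_weight_cube fin ne
          continuous_map_log_profile[unfolded gibbs_closure_def]
          inj_on_log_profile[unfolded gibbs_closure_def] indep)
  moreover have "subtopology (weight_cube V) (gibbs_closure V) homeomorphic_space top_of_set ?K"
    unfolding hull by (rule gibbs_closure_homeomorphic_hull[OF fin int])
  ultimately show ?thesis
    using homeomorphic_space_sym homeomorphic_space_trans by blast
qed

theorem corollary1p2:
  fixes N :: "real ^ 'n \<Rightarrow> real"
  assumes "rational_polyhedral_norm N"
  shows "horofunction_compactification N homeomorphic_space
           top_of_set (polar_set (unit_ball N))"
  using assms horofunction_compactification_homeomorphic_polar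
  by (auto simp: rational_polyhedral_norm_def)

end
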